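(* Let $k,m$ be positive integers with $m\ge 5$ and let $b\in\{0,2,4,\ldots\}$. If $b\equiv 0\pmod 4$, then $$U_{k\varphi(5^m)+b}-(1+5^b)U_b\equiv 5^{m-1}k(7545+5050b-5375b^2+1250b^3+3125b^4+9375b^5)\pmod{5^{m+5}}.$$ If $b\equiv 2\pmod 4$, then $$U_{k\varphi(5^m)+b}-(1+5^b)U_b\equiv 5^{m-1}k(-1575+5350b+2250b^2+7500b^3+3125b^5)\pmod{5^{m+5}}.$$
   Context: The integer sequence $\{U_n\}_{n\ge0}$ is defined by $U_0=1$ and $U_n=-2\sum_{j=1}^{\lfloor n/2\rfloor}\binom{n}{2j}U_{n-2j}$ for $n\ge 1$. $\varphi$ denotes Euler's totient function. *)

theory Defs
  imports "HOL-Number_Theory.Number_Theory"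
begin

function U :: "nat \<Rightarrow> int" where
  "U n = (if n = 0 then 1
          else - 2 * (\<Sum>j = 1..n div 2. int (n choose (2 * j)) * U (n - 2 * j)))"
  by auto
termination
  by (relation "measure id") auto

text \<open>The defining equation has no constructor pattern on the left and would loop in the
  simplifier.\<close>
declare U.simps [simp del]

lemma U_0: "U 0 = 1"
  by (simp add: U.simps)

lemma U_rec:
  "n \<ge> 1 \<Longrightarrow> U n = - 2 * (\<Sum>j = 1..n div 2. int (n choose (2 * j)) * U (n - 2 * j))"
  by (subst U.simps) simp

end

theory Submission
  imports Defs "HOL-Computational_Algebra.Formal_Power_Series"
begin

text \<open>
  The exponential generating function of U is 1 / (e^x + e^(-x) - 1) = (e^x + e^(2x)) / (1 + e^(3x)),
  so that 2 U n is, modulo an odd M, the sum of chi6 x * x^n over x < 3 M, where chi6 has period 6 and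
  values 0, 1, 1, 0, -1, -1.  As chi6 (5 x) = - chi6 x, dropping the multiples of 5 from the sum
  replaces U n by (1 + 5^n) U n.  For n = 4 t + b each remaining x contributes a multiple of (1 + w)^t,
  where w = x^4 - 1 is divisible by 5; hence f(t) = 2 (1 + 5^n) U n has a Newton expansion whose r-th
  coefficient is divisible by 5^r.  In the difference f(K + B) - f(B) with K = 5^(m-1) k, the terms
  with r at least 7 vanish modulo 5^(m+5), and in the others the binomial coefficient of K + B over r
  may be replaced by its Taylor polynomial of degree 1 in K.  What remains is K times a polynomial in B
  whose coefficients are determined by the values U n with n at most 26.
\<close>

section \<open>The recurrence as an identity of exponential generating functions\<close>

text \<open>Coefficient form of (e^x + e^(-x)) F = F + 1 for the generating function F of
  \<open>U\<close>. The factor 1 + (-1)^(n-i) keeps the even differences and doubles them; by the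
  recurrence the terms with positive difference add up to - U n, against 2 U n from i = n. The
  recurrence does not cover n = 0, hence the extra 1.\<close>

lemma U_even_convolution:
  "(\<Sum>i\<le>n. int (n choose i) * (1 + (-1) ^ (n - i)) * U i) = U n + (if n = 0 then 1 else 0)"
proof (cases "n = 0")
  case True
  then show ?thesis by (simp add: U_0)
next
  case False
  have "(\<Sum>i\<le>n. int (n choose i) * (1 + (-1) ^ (n - i)) * U i) =
        (\<Sum>j\<le>n. int (n choose j) * (1 + (-1) ^ j) * U (n - j))"
    by (rule sum.reindex_bij_witness[of _ "\<lambda>j. n - j" "\<lambda>j. n - j"])
       (auto simp: binomial_symmetric[symmetric])
  also have "\<dots> = (\<Sum>j\<in>{j. j \<le> n \<and> even j}. 2 * int (n choose j) * U (n - j))"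
    by (rule sum.mono_neutral_cong_right) auto
  also have "\<dots> = (\<Sum>j\<le>n div 2. 2 * int (n choose (2 * j)) * U (n - 2 * j))"
    by (rule sum.reindex_bij_witness[of _ "\<lambda>j. 2 * j" "\<lambda>j. j div 2"]) auto
  also have "\<dots> = 2 * U n + 2 * (\<Sum>j = 1..n div 2. int (n choose (2 * j)) * U (n - 2 * j))"
    by (simp add: atMost_atLeast0 sum.atLeast_Suc_atMost sum_distrib_left mult.assoc)
  also have "\<dots> = U n"
    using U_rec[of n] False by simp
  finally show ?thesis using False by simp
qed

definition U_egf :: "rat fps" where
  "U_egf = Abs_fps (\<lambda>n. of_int (U n) / fact n)"

lemma U_egf_inverse: "U_egf * (fps_exp 1 + fps_exp (-1) - 1) = 1"
proof (rule fps_ext)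
  fix n
  have "fps_nth (U_egf * (fps_exp 1 + fps_exp (-1) - 1)) n =
    (\<Sum>i\<le>n. of_int (U i) / fact i * ((1 + (-1) ^ (n - i)) / fact (n - i)))
    - (\<Sum>i\<le>n. if i = n then of_int (U i) / fact i else 0)"
    unfolding U_egf_def fps_mult_nth atMost_atLeast0 sum_subtractf[symmetric]
    by (rule sum.cong) (auto simp: field_simps)
  also have "(\<Sum>i\<le>n. of_int (U i) / fact i * ((1 + (-1) ^ (n - i)) / fact (n - i)) :: rat) =
      (\<Sum>i\<le>n. of_int (int (n choose i) * (1 + (-1) ^ (n - i)) * U i) / fact n)"
    by (rule sum.cong) (auto simp: binomial_fact field_simps)
  also have "\<dots> = of_int (U n + (if n = 0 then 1 else 0)) / fact n"
    by (simp only: U_even_convolution[symmetric] of_int_sum sum_divide_distrib)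
  finally show "fps_nth (U_egf * (fps_exp 1 + fps_exp (-1) - 1)) n = fps_nth 1 n"
    by (simp add: add_divide_distrib)
qed

section \<open>Power sums weighted by a sequence of period 6\<close>

text \<open>These are the power series coefficients of (z + z^2) / (1 + z^3), which at z = e^x is
  the generating function of \<open>U\<close>.\<close>

definition chi6 :: "nat \<Rightarrow> int" where
  "chi6 x = (if x mod 6 \<in> {1, 2} then 1 else if x mod 6 \<in> {4, 5} then -1 else 0)"

text \<open>5 is -1 modulo 6, and \<open>chi6\<close> is an odd function modulo 6.\<close>

lemma chi6_5_mult: "chi6 (5 * x) = - chi6 x"
proof -
  have "(5 * x) mod 6 = (5 * (x mod 6)) mod 6" by (simp add: mod_mult_right_eq)
  moreover have "x mod 6 < 6" by simp
  then have "x mod 6 \<in> {0,1,2,3,4,5}" by auto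
  ultimately show ?thesis by (auto simp: chi6_def)
qed

lemma chi6_3_mult:
  "chi6 (3 * M) = 0" "chi6 (3 * M + 1) = (-1) ^ M" "chi6 (3 * M + 2) = (-1) ^ M"
proof -
  consider (e) j where "M = 2 * j" | (o) j where "M = 2 * j + 1" by (metis evenE oddE)
  then have "chi6 (3 * M) = 0 \<and> chi6 (3 * M + 1) = (-1) ^ M \<and> chi6 (3 * M + 2) = (-1) ^ M"
  proof cases
    case e
    have "(6 * j) mod 6 = 0" "(6 * j + 1) mod 6 = 1" "(6 * j + 2) mod 6 = 2" by presburger+
    with e show ?thesis by (simp add: chi6_def)
  next
    case o
    have "(6 * j + 3) mod 6 = 3" "(6 * j + 4) mod 6 = 4" "(6 * j + 5) mod 6 = 5" by presburger+
    with o show ?thesis by (simp add: chi6_def add.commute)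
  qed
  then show "chi6 (3 * M) = 0" "chi6 (3 * M + 1) = (-1) ^ M" "chi6 (3 * M + 2) = (-1) ^ M"
    by auto
qed

lemma sum_3_Suc:
  fixes f :: "nat \<Rightarrow> 'a::comm_monoid_add"
  shows "(\<Sum>x<3 * Suc M. f x) = (\<Sum>x<3 * M. f x) + (f (3 * M) + (f (3 * M + 1) + f (3 * M + 2)))"
proof -
  have "3 * Suc M = Suc (Suc (Suc (3 * M)))" by simp
  then show ?thesis by (simp only: sum.lessThan_Suc) (simp add: add.assoc)
qed

text \<open>With z = e^x, a block of three consecutive terms times the kernel z + 1/z - 1 is (-1)^M
  (z^(3M) + z^(3M+3)), so the sum over blocks telescopes.\<close>

lemma sum_chi6_egf:
  "(\<Sum>x<3 * M. of_int (chi6 x) * fps_exp (of_nat x)) * (fps_exp 1 + fps_exp (-1) - 1 :: rat fps)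
    = 1 - (-1) ^ M * fps_exp (of_nat (3 * M))"
proof (induction M)
  case (Suc M)
  have e: "fps_exp (x::rat) * fps_exp y = fps_exp (x + y)" for x y
    by (simp add: fps_exp_add_mult)
  have "(fps_exp (of_nat (3 * M + 1)) + fps_exp (of_nat (3 * M + 2))) *
      (fps_exp 1 + fps_exp (-1) - 1 :: rat fps) =
      fps_exp (of_nat (3 * M)) + fps_exp (of_nat (3 * Suc M))"
    by (simp add: algebra_simps e)
  then have "(S + ((-1) ^ M * fps_exp (of_nat (3 * M + 1)) + (-1) ^ M * fps_exp (of_nat (3 * M + 2)))) *
      (fps_exp 1 + fps_exp (-1) - 1 :: rat fps) = S * (fps_exp 1 + fps_exp (-1) - 1) +
      (-1) ^ M * (fps_exp (of_nat (3 * M)) + fps_exp (of_nat (3 * Suc M)))" for S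
    by (metis (no_types, opaque_lifting) distrib_left distrib_right mult.assoc)
  note step = this
  show ?case
    unfolding sum_3_Suc chi6_3_mult of_int_0 of_int_power of_int_minus of_int_1 mult_zero_left
      add_0_left step Suc.IH
    by (simp add: ring_distribs del: of_nat_mult of_nat_add of_nat_Suc mult_Suc_right)
qed simp

text \<open>Multiplying \<open>sum_chi6_egf\<close> by \<open>U_egf\<close> cancels the kernel, and
  oddness of M turns the sign into a plus. The claim compares the coefficients of x^n, scaled by
  n!.\<close>

lemma sum_chi6_power:
  assumes "odd M"
  shows "(\<Sum>x<3 * M. chi6 x * int x ^ n) =
    U n + (\<Sum>i\<le>n. int (n choose i) * U i * int (3 * M) ^ (n - i))"
proof -
  let ?S = "\<Sum>x<3 * M. of_int (chi6 x) * fps_exp (of_nat x) :: rat fps"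
  have "?S = U_egf * (?S * (fps_exp 1 + fps_exp (-1) - 1))"
    by (simp only: mult.left_commute[of U_egf] U_egf_inverse mult_1_right)
  also have "\<dots> = U_egf + U_egf * fps_exp (of_nat (3 * M))"
    unfolding sum_chi6_egf using assms by (simp add: distrib_left)
  finally have "fps_nth ?S n * fact n = fps_nth (U_egf + U_egf * fps_exp (of_nat (3 * M))) n * fact n"
    by simp
  also have "fps_nth ?S n * fact n = of_int (\<Sum>x<3 * M. chi6 x * int x ^ n)"
    by (simp add: fps_sum_nth sum_distrib_right fps_of_int[symmetric])
  also have "fps_nth (U_egf + U_egf * fps_exp (of_nat (3 * M))) n * fact n =
     of_int (U n + (\<Sum>i\<le>n. int (n choose i) * U i * int (3 * M) ^ (n - i)))"
    by (simp add: U_egf_def fps_mult_nth atMost_atLeast0 ring_distribs sum_distrib_right)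
       (rule sum.cong, auto simp: binomial_fact field_simps)
  finally show ?thesis by (simp only: of_int_eq_iff)
qed

text \<open>All terms with \<open>i < n\<close> carry a factor M; the term \<open>i = n\<close>
  supplies the second U n.\<close>

lemma sum_chi6_power_cong:
  assumes "odd M"
  shows "[(\<Sum>x<3 * M. chi6 x * int x ^ n) = 2 * U n] (mod int M)"
proof -
  have "int M dvd (\<Sum>i<n. int (n choose i) * U i * int (3 * M) ^ (n - i))"
    by (rule dvd_sum) (auto intro!: dvd_mult dvd_power_le[of _ _ 1, simplified] simp: Suc_leI)
  then show ?thesis
    unfolding sum_chi6_power[OF assms] cong_iff_dvd_diff
    by (simp add: lessThan_Suc_atMost[symmetric])
qed

text \<open>By \<open>chi6_5_mult\<close> the multiples of 5 contribute -5^n times the sum over a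
  range shorter by a factor 5; removing them creates 1 + 5^n. The exponent \<open>Suc N\<close>
  ensures that this shorter range still gives a congruence modulo 5^N.\<close>

lemma sum_chi6_power_coprime_cong:
  defines "A \<equiv> \<lambda>N. {x. x < 3 * 5 ^ Suc N \<and> \<not> 5 dvd x}"
  shows "[(\<Sum>x\<in>A N. chi6 x * int x ^ n) = 2 * (1 + 5 ^ n) * U n] (mod 5 ^ N)"
proof -
  let ?f = "\<lambda>x. chi6 x * int x ^ n"
  have "sum ?f {..<3 * 5 ^ Suc N} = sum ?f (A N) + sum ?f {x. x < 3 * 5 ^ Suc N \<and> 5 dvd x}"
    by (subst sum.union_disjoint[symmetric]) (auto simp: A_def intro: sum.cong)
  also have "sum ?f {x. x < 3 * 5 ^ Suc N \<and> 5 dvd x} = (\<Sum>x<3 * 5 ^ N. ?f (5 * x))"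
    by (rule sum.reindex_bij_witness[of _ "\<lambda>x. 5 * x" "\<lambda>x. x div 5"]) auto
  also have "\<dots> = - (5 ^ n * (\<Sum>x<3 * 5 ^ N. ?f x))"
    unfolding sum_distrib_left sum_negf[symmetric]
    by (rule sum.cong) (simp_all add: chi6_5_mult power_mult_distrib)
  finally have eq: "sum ?f (A N) = sum ?f {..<3 * 5 ^ Suc N} + 5 ^ n * (\<Sum>x<3 * 5 ^ N. ?f x)"
    by simp
  have "[sum ?f {..<3 * 5 ^ Suc N} = 2 * U n] (mod 5 ^ N)"
    using sum_chi6_power_cong[of "5 ^ Suc N" n]
    by (auto elim: cong_dvd_modulus)
  moreover have "[(\<Sum>x<3 * 5 ^ N. ?f x) = 2 * U n] (mod 5 ^ N)"
    using sum_chi6_power_cong[of "5 ^ N" n] by simp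
  ultimately have "[sum ?f (A N) = 2 * U n + 5 ^ n * (2 * U n)] (mod 5 ^ N)"
    unfolding eq by (intro cong_add cong_mult cong_refl)
  then show ?thesis by (simp add: algebra_simps)
qed

section \<open>Kummer congruences for the base 5\<close>

lemma five_dvd_power4_minus_1:
  assumes "\<not> 5 dvd (x::nat)"
  shows "(5::int) dvd int x ^ 4 - 1"
proof -
  have "x mod 5 < 5" by simp
  with assms have "x mod 5 \<in> {1, 2, 3, 4}" by (auto simp: dvd_eq_mod_eq_0)
  then have "(x mod 5) ^ 4 mod 5 = 1" by auto
  then have "[x ^ 4 = 1] (mod 5)" by (simp add: cong_def power_mod)
  then have "[int (x ^ 4) = int 1] (mod int 5)" by (simp only: cong_int_iff)
  then show ?thesis by (simp add: cong_iff_dvd_diff)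
qed

text \<open>The factor 2 of the power sums is kept to avoid division. Raising \<open>n\<close> by 1
  multiplies each term of the underlying sum by x^4, which is 1 modulo 5.\<close>

definition kummer :: "nat \<Rightarrow> nat \<Rightarrow> int" where
  "kummer b n = 2 * (1 + 5 ^ (4 * n + b)) * U (4 * n + b)"

text \<open>Expanding (1 + w)^n with w = x^4 - 1 under the sum gives the Newton expansion, and
  expanding (x^4 - 1)^r gives its inversion. The witness \<open>d\<close> is a finite sum depending
  on N; its divisibility by 5^r is exact, the other two claims hold modulo 5^N.\<close>

lemma kummer_newton:
  obtains d :: "nat \<Rightarrow> int" where
    "\<And>r. 5 ^ r dvd d r"
    "\<And>n. [kummer b n = (\<Sum>r\<le>n. int (n choose r) * d r)] (mod 5 ^ N)"
    "\<And>r. [d r = (\<Sum>j\<le>r. (-1) ^ (r - j) * int (r choose j) * kummer b j)] (mod 5 ^ N)"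
proof
  let ?A = "{x::nat. x < 3 * 5 ^ Suc N \<and> \<not> 5 dvd x}"
  define d where "d r = (\<Sum>x\<in>?A. chi6 x * int x ^ b * (int x ^ 4 - 1) ^ r)" for r
  have cong: "[(\<Sum>x\<in>?A. chi6 x * int x ^ b * (int x ^ 4) ^ n) = kummer b n] (mod 5 ^ N)" for n
    using sum_chi6_power_coprime_cong[where N = N and n = "4 * n + b"]
    unfolding kummer_def by (simp only: power_add power_mult mult.assoc mult.commute[of "int _ ^ b"])
  show "5 ^ r dvd d r" for r
    unfolding d_def
    by (rule dvd_sum) (auto intro!: dvd_mult dvd_power_same five_dvd_power4_minus_1)
  show "[kummer b n = (\<Sum>r\<le>n. int (n choose r) * d r)] (mod 5 ^ N)" for n
  proof -
    have "(\<Sum>x\<in>?A. chi6 x * int x ^ b * (int x ^ 4) ^ n) =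
        (\<Sum>x\<in>?A. \<Sum>r\<le>n. int (n choose r) * (chi6 x * int x ^ b * (int x ^ 4 - 1) ^ r))"
      using binomial_ring[of "int x ^ 4 - 1" 1 n for x]
      by (simp add: sum_distrib_left mult_ac)
    also have "\<dots> = (\<Sum>r\<le>n. int (n choose r) * d r)"
      unfolding d_def sum_distrib_left by (rule sum.swap)
    finally show ?thesis using cong[of n] by (simp add: cong_sym_eq)
  qed
  show "[d r = (\<Sum>j\<le>r. (-1) ^ (r - j) * int (r choose j) * kummer b j)] (mod 5 ^ N)" for r
  proof -
    have "d r = (\<Sum>x\<in>?A. \<Sum>j\<le>r. (-1) ^ (r - j) * int (r choose j) *
        (chi6 x * int x ^ b * (int x ^ 4) ^ j))"
      using binomial_ring[of "int x ^ 4" "-1" r for x]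
      by (simp add: d_def sum_distrib_left mult_ac)
    also have "\<dots> = (\<Sum>j\<le>r. (-1) ^ (r - j) * int (r choose j) *
        (\<Sum>x\<in>?A. chi6 x * int x ^ b * (int x ^ 4) ^ j))"
      unfolding sum_distrib_left by (rule sum.swap)
    finally show ?thesis
      using cong by (simp only:) (intro cong_sum cong_mult cong_refl)
  qed
qed

section \<open>Increments of binomial coefficients and powers of 5\<close>

lemma fact_times_binomial_int: "fact r * int (n choose r) = (\<Prod>i<r. int n - int i)"
proof -
  have "of_int (fact r * int (n choose r)) = (of_int (\<Prod>i<r. int n - int i) :: rat)"
    using gbinomial_mult_fact[of r "of_nat n :: rat"]
    by (simp add: binomial_gbinomial lessThan_atLeast0)
  then show ?thesis by (simp only: of_int_eq_iff)
qed

text \<open>The derivative of the falling factorial y (y - 1) ... (y - r + 1).\<close>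

primrec ffact_deriv :: "nat \<Rightarrow> int \<Rightarrow> int" where
  "ffact_deriv 0 y = 0"
| "ffact_deriv (Suc r) y = ffact_deriv r y * (y - int r) + (\<Prod>i<r. y - int i)"

lemma ffact_taylor:
  fixes y h :: int
  shows "h\<^sup>2 dvd (\<Prod>i<r. h + y - int i) - (\<Prod>i<r. y - int i) - h * ffact_deriv r y"
proof (induction r)
  case (Suc r)
  then obtain q where q: "(\<Prod>i<r. h + y - int i) = (\<Prod>i<r. y - int i) + h * ffact_deriv r y + h\<^sup>2 * q"
    by (auto simp: dvd_def algebra_simps)
  have "(\<Prod>i<Suc r. h + y - int i) - (\<Prod>i<Suc r. y - int i) - h * ffact_deriv (Suc r) y =
      h\<^sup>2 * (ffact_deriv r y + q * (h + y - int r))"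
    by (simp add: q algebra_simps power2_eq_square)
  then show ?case by (simp only: dvd_triv_left)
qed simp

text \<open>The factor 720 clears the denominators r!.  It contains a single 5, which is why the modulus
  is 5^(m+6) rather than 5^(m+5).\<close>

lemma binomial_diff_cong_deriv:
  fixes K B m r :: nat and e :: int
  assumes "5 ^ (m - 1) dvd K" "m \<ge> 5" "5 ^ r dvd e" "r \<le> 6"
  shows "[720 * ((int ((K + B) choose r) - int (B choose r)) * e) =
      int K * (720 div fact r * ffact_deriv r (int B) * e)] (mod 5 ^ (m + 6))"
proof -
  let ?R = "(\<Prod>i<r. int K + int B - int i) - (\<Prod>i<r. int B - int i)
      - int K * ffact_deriv r (int B)"
  define c :: int where "c = 720 div fact r"
  have "r \<in> {0, 1, 2, 3, 4, 5, 6}" using assms(4) by auto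
  then have c: "720 = c * fact r" by (auto simp: c_def fact_numeral)
  have eq: "720 * ((int ((K + B) choose r) - int (B choose r)) * e) - int K * (c * ffact_deriv r (int B) * e)
     = ?R * (c * e)"
    using fact_times_binomial_int[of r "K + B"] fact_times_binomial_int[of r B]
    unfolding c by (simp add: algebra_simps)
  have "5 ^ (m + 6) dvd ?R * (c * e)"
  proof (cases "r \<le> 1")
    \<comment> \<open>For r = 0 and r = 1 the falling factorial is affine, so the Taylor remainder
      is zero.\<close>
    case True
    then have "r = 0 \<or> r = 1" by auto
    then show ?thesis by auto
  next
    case False
    have "int 5 ^ (m - 1) dvd int K" using assms(1) by (metis of_nat_dvd_iff of_nat_power)
    then have "(5 ^ (m - 1))\<^sup>2 dvd (int K)\<^sup>2" by (intro dvd_power_same) simp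
    \<comment> \<open>The inequality 2 (m - 1) >= m + 3 is exactly m >= 5.\<close>
    moreover have "(5::int) ^ (m + 3) dvd (5 ^ (m - 1))\<^sup>2"
      unfolding power_mult[symmetric] using assms(2) by (intro le_imp_power_dvd) simp
    ultimately have "5 ^ (m + 3) dvd ?R"
      using ffact_taylor[where h = "int K" and r = r and y = "int B"] by (blast intro: dvd_trans)
    \<comment> \<open>For r = 2 the factor \<open>e\<close> guarantees only 5^2; the third 5 comes
      from c = 360.\<close>
    moreover have "5 ^ 3 dvd c * e"
    proof (cases "r = 2")
      case True
      have "5 * 5 ^ 2 dvd c * e"
        using assms(3) True by (intro mult_dvd_mono) (auto simp: c_def fact_numeral)
      then show ?thesis by simp
    next
      case False
      with \<open>\<not> r \<le> 1\<close> have "(5::int) ^ 3 dvd 5 ^ r" by (intro le_imp_power_dvd) auto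
      then show ?thesis using assms(3) dvd_trans by (blast intro: dvd_mult)
    qed
    ultimately have "5 ^ (m + 3) * 5 ^ 3 dvd
        ?R * (c * e)"
      by (rule mult_dvd_mono)
    moreover have "5 ^ (m + 3) * 5 ^ 3 = (5::int) ^ (m + 6)" by (simp add: power_add)
    ultimately show ?thesis by (simp only:)
  qed
  then show ?thesis unfolding cong_iff_dvd_diff eq[unfolded c_def] c_def .
qed

text \<open>Bounds the 5-adic valuation of any index up to r by r - 6. The inequality fails at r =
  6, so the terms up to 6 are handled by the Taylor expansion instead.\<close>

lemma less_five_power: "7 \<le> r \<Longrightarrow> r < 5 ^ (r - 5)"
proof (induction r rule: dec_induct)
  case (step n)
  then have "Suc n - 5 = Suc (n - 5)" by simp
  with step show ?case by simp
qed simp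

text \<open>Since i (K choose i) = K (K-1 choose i-1), the binomial coefficient loses at most the
  valuation v of i from 5^a. As v <= r - 6, the factor 5^r makes up for it with 6 to spare.\<close>

lemma five_power_dvd_binomial:
  assumes "5 ^ a dvd K" "0 < i" "i \<le> r" "7 \<le> r"
  shows "5 ^ (a + 6) dvd (K choose i) * 5 ^ r"
proof -
  obtain v u where v: "i = 5 ^ v * u" "\<not> 5 dvd u"
  proof (rule multiplicity_decompose'[of i 5])
    show "i \<noteq> 0" using \<open>0 < i\<close> by simp
  qed simp
  have "5 ^ v \<le> r"
    using v assms(2,3) by (metis dvd_imp_le dvd_triv_left le_trans)
  then have "v < r - 5"
    using less_five_power[OF assms(4)] by (metis le_less_trans nat_power_less_imp_less zero_less_numeral)
  then have le: "a + 6 + v \<le> a + r" by simp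
  have "5 ^ a dvd i * (K choose i)"
    using assms(1,2) times_binomial_minus1_eq[of i K] by simp
  then have "5 ^ a * 5 ^ r dvd i * (K choose i) * 5 ^ r" by (rule mult_dvd_mono) simp
  then have "5 ^ (a + 6 + v) dvd i * (K choose i) * 5 ^ r"
    using le_imp_power_dvd[OF le, of "5::nat"] by (metis dvd_trans power_add)
  then have "5 ^ v * 5 ^ (a + 6) dvd 5 ^ v * (u * ((K choose i) * 5 ^ r))"
    by (simp add: v(1) power_add mult_ac)
  then have "5 ^ (a + 6) dvd u * ((K choose i) * 5 ^ r)" by simp
  moreover have "coprime (5 ^ (a + 6)) u"
    using v(2) by (simp add: prime_imp_coprime)
  ultimately show ?thesis by (simp add: coprime_dvd_mult_right_iff)
qed

text \<open>In Vandermonde's identity the term i = 0 is \<open>B choose r\<close> and cancels; every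
  other term contains some \<open>K choose i\<close> with 0 < i <= r.\<close>

lemma five_power_dvd_binomial_diff:
  assumes "5 ^ a dvd K" "7 \<le> r" "5 ^ r dvd (e::int)"
  shows "5 ^ (a + 6) dvd (int ((K + B) choose r) - int (B choose r)) * e"
proof -
  have "(K + B) choose r = (\<Sum>i\<le>r. (K choose i) * (B choose (r - i)))"
    by (rule vandermonde[symmetric])
  also have "\<dots> = (B choose r) + (\<Sum>i=1..r. (K choose i) * (B choose (r - i)))"
    by (simp add: atMost_atLeast0 sum.atLeast_Suc_atMost)
  finally have "int ((K + B) choose r) - int (B choose r) =
      int (\<Sum>i=1..r. (K choose i) * (B choose (r - i)))" by simp
  moreover have "5 ^ (a + 6) dvd (\<Sum>i=1..r. (K choose i) * (B choose (r - i))) * 5 ^ r"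
    unfolding sum_distrib_right
  proof (rule dvd_sum)
    fix i assume "i \<in> {1..r}"
    then have "5 ^ (a + 6) dvd (K choose i) * 5 ^ r"
      using assms by (intro five_power_dvd_binomial) auto
    then show "5 ^ (a + 6) dvd (K choose i) * (B choose (r - i)) * 5 ^ r"
      by (metis dvd_mult mult.assoc mult.commute)
  qed
  then have "int (5 ^ (a + 6)) dvd int ((\<Sum>i=1..r. (K choose i) * (B choose (r - i))) * 5 ^ r)"
    by (simp only: of_nat_dvd_iff)
  ultimately have "5 ^ (a + 6) dvd (int ((K + B) choose r) - int (B choose r)) * 5 ^ r"
    by simp
  then show ?thesis using assms(3) by (meson dvd_refl dvd_trans mult_dvd_mono)
qed

section \<open>First-order congruences for differences\<close>

text \<open>The Newton coefficients are needed only modulo 5^7, because K contributes the remaining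
  5^(m-1). This makes the right-hand side computable from finitely many residues
  \<open>e r\<close>.\<close>

lemma kummer_diff_cong:
  fixes K B m b :: nat and e :: "nat \<Rightarrow> int"
  assumes K: "5 ^ (m - 1) dvd K" "K > 0" and m: "m \<ge> 5"
    and e: "\<And>r. 0 < r \<Longrightarrow> r \<le> 6 \<Longrightarrow>
      [(\<Sum>j\<le>r. (-1) ^ (r - j) * int (r choose j) * kummer b j) = e r] (mod 5 ^ 7)"
  shows "[720 * (kummer b (K + B) - kummer b B) =
      int K * (\<Sum>r=1..6. 720 div fact r * ffact_deriv r (int B) * e r)] (mod 5 ^ (m + 6))"
proof -
  obtain d where d: "\<And>r. 5 ^ r dvd d r"
    "\<And>n. [kummer b n = (\<Sum>r\<le>n. int (n choose r) * d r)] (mod 5 ^ (m + 6))"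
    "\<And>r. [d r = (\<Sum>j\<le>r. (-1) ^ (r - j) * int (r choose j) * kummer b j)] (mod 5 ^ (m + 6))"
    using kummer_newton[of b "m + 6"] by blast
  let ?t = "\<lambda>r. (int ((K + B) choose r) - int (B choose r)) * d r"
  let ?D = "\<lambda>r. 720 div fact r * ffact_deriv r (int B)"
  have "6 \<le> (5::nat) ^ 4" by simp
  also have "(5::nat) ^ 4 \<le> 5 ^ (m - 1)" using m by (intro power_increasing) auto
  also have "\<dots> \<le> K" using K by (rule dvd_imp_le)
  finally have "6 \<le> K" .
  \<comment> \<open>Padding with vanishing binomial coefficients gives both expansions the same
    range.\<close>
  have "(\<Sum>r\<le>B. int (B choose r) * d r) = (\<Sum>r\<le>K + B. int (B choose r) * d r)"
    by (rule sum.mono_neutral_left) (auto simp: not_le)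
  with cong_diff[OF d(2)[of "K + B"] d(2)[of B]]
  have "[kummer b (K + B) - kummer b B = (\<Sum>r\<le>K + B. ?t r)] (mod 5 ^ (m + 6))"
    by (simp add: sum_subtractf left_diff_distrib)
  then have "[720 * (kummer b (K + B) - kummer b B) = 720 * (\<Sum>r\<le>K + B. ?t r)] (mod 5 ^ (m + 6))"
    by (rule cong_mult[OF cong_refl])
  also have "{..K + B} = insert 0 {1..6} \<union> {7..K + B}"
    using \<open>6 \<le> K\<close> by auto
  \<comment> \<open>The term at 0 vanishes, both binomial coefficients being 1.\<close>
  also have "720 * sum ?t (insert 0 {1..6} \<union> {7..K + B}) =
      (\<Sum>r=1..6. 720 * ?t r) + 720 * sum ?t {7..K + B}"
    by (subst sum.union_disjoint) (auto simp: sum_distrib_left)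
  also have "[\<dots> = (\<Sum>r=1..6. int K * (?D r * e r)) + 0] (mod 5 ^ (m + 6))"
  proof (intro cong_add cong_sum)
    fix r :: nat assume r: "r \<in> {1..6}"
    have "[720 * ?t r = int K * (?D r * d r)] (mod 5 ^ (m + 6))"
      using binomial_diff_cong_deriv[OF K(1) m d(1), of r B] r by simp
    also have "[int K * (?D r * d r) = int K * (?D r * e r)] (mod 5 ^ (m + 6))"
    proof -
      have "[d r = e r] (mod 5 ^ 7)"
        using cong_trans[OF cong_dvd_modulus[OF d(3)[of r] le_imp_power_dvd] e[of r]] r m by simp
      then have "5 ^ (m - 1) * 5 ^ 7 dvd int K * (?D r * (d r - e r))"
        unfolding cong_iff_dvd_diff using K(1)
        by (intro mult_dvd_mono dvd_mult) (metis of_nat_dvd_iff of_nat_numeral of_nat_power)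
      moreover have "5 ^ (m - 1) * 5 ^ 7 = (5::int) ^ (m + 6)"
        unfolding power_add[symmetric] using m by simp
      ultimately have "5 ^ (m + 6) dvd int K * (?D r * (d r - e r))" by (simp only:)
      then show ?thesis by (simp add: cong_iff_dvd_diff algebra_simps)
    qed
    finally show "[720 * ?t r = int K * (?D r * e r)] (mod 5 ^ (m + 6))" .
  next
    have "5 ^ (m - 1 + 6) dvd sum ?t {7..K + B}"
      using K(1) d(1) by (intro dvd_sum five_power_dvd_binomial_diff) auto
    \<comment> \<open>The factor 5 in 720 raises the exponent from m + 5 to m + 6.\<close>
    then have "5 * 5 ^ (m - 1 + 6) dvd 720 * sum ?t {7..K + B}"
      by (intro mult_dvd_mono) auto
    moreover have "5 * 5 ^ (m - 1 + 6) = (5 :: int) ^ (m + 6)"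
      using m by (simp flip: power_Suc)
    ultimately show "[720 * sum ?t {7..K + B} = 0] (mod 5 ^ (m + 6))"
      by (simp add: cong_0_iff)
  qed
  finally show ?thesis by (simp add: sum_distrib_left)
qed

text \<open>Here 1440 is 720 times the 2 in \<open>kummer\<close>, and \<open>q\<close> absorbs
  multiples of 5^7, which vanish after multiplication by K. What remains is to exhibit
  \<open>P\<close> and \<open>q\<close> for explicit differences \<open>e\<close>.\<close>

lemma U_cong_from_ffact_deriv:
  fixes K B m b :: nat and e :: "nat \<Rightarrow> int" and P q :: int
  assumes K: "5 ^ (m - 1) dvd K" "K > 0" and m: "m \<ge> 5"
    and e: "\<And>r. 0 < r \<Longrightarrow> r \<le> 6 \<Longrightarrow>
      [(\<Sum>j\<le>r. (-1) ^ (r - j) * int (r choose j) * kummer b j) = e r] (mod 5 ^ 7)"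
    and P: "(\<Sum>r=1..6. 720 div fact r * ffact_deriv r (int B) * e r) = 1440 * P + 5 ^ 7 * q"
  shows "[U (4 * (K + B) + b) - (1 + 5 ^ (4 * B + b)) * U (4 * B + b) = int K * P] (mod 5 ^ (m + 5))"
proof -
  let ?n = "4 * (K + B) + b"
  \<comment> \<open>K is at least m, so the index \<open>?n\<close> is at least m + 6 and the factor
    1 + 5^?n becomes 1.\<close>
  have "Suc (m - 1) \<le> 5 ^ (m - 1)" 
    using less_exp[of "m - 1"] power_mono[of 2 "5::nat" "m - 1"] by linarith
  also have "\<dots> \<le> K" using K by (rule dvd_imp_le)
  finally have "m \<le> K" using m by simp
  with m have "m + 6 \<le> ?n" by simp
  then have "(5::int) ^ (m + 6) dvd 5 ^ ?n" by (rule le_imp_power_dvd)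
  then have 1: "[kummer b (K + B) = 2 * U ?n] (mod 5 ^ (m + 6))"
    by (simp add: kummer_def cong_iff_dvd_diff algebra_simps)
  have 2: "[int K * (5 ^ 7 * q) = 0] (mod 5 ^ (m + 6))"
  proof -
    have "5 ^ (m - 1) dvd int K"
      using K(1) by (metis of_nat_dvd_iff of_nat_numeral of_nat_power)
    then have "5 ^ (m - 1) * 5 ^ 7 dvd int K * (5 ^ 7 * q)"
      by (rule mult_dvd_mono) (rule dvd_triv_left)
    moreover have "5 ^ (m - 1) * 5 ^ 7 = (5::int) ^ (m + 6)"
      unfolding power_add[symmetric] using m by simp
    ultimately show ?thesis by (simp only: cong_0_iff)
  qed
  have "[720 * (2 * U ?n - kummer b B) = 720 * (kummer b (K + B) - kummer b B)] (mod 5 ^ (m + 6))"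
    using 1 by (intro cong_mult cong_diff cong_refl) (rule cong_sym)
  also have "[720 * (kummer b (K + B) - kummer b B) = int K * (1440 * P + 5 ^ 7 * q)] (mod 5 ^ (m + 6))"
    using kummer_diff_cong[OF K m e, of B] by (simp only: P)
  also have "[int K * (1440 * P + 5 ^ 7 * q) = int K * (1440 * P) + 0] (mod 5 ^ (m + 6))"
    unfolding distrib_left by (intro cong_add cong_refl 2)
  finally have "5 ^ (m + 6) dvd 1440 * (U ?n - (1 + 5 ^ (4 * B + b)) * U (4 * B + b) - int K * P)"
    by (simp add: cong_iff_dvd_diff kummer_def algebra_simps)
  \<comment> \<open>Cancelling the single 5 in 1440 lowers the modulus to 5^(m+5); the cofactor 288
    is a unit modulo 5.\<close>
  moreover have "1440 * y = 5 * (288 * y)" for y :: int by simp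
  moreover have "(5::int) ^ (m + 6) = 5 * 5 ^ (m + 5)" by (simp add: power_add)
  ultimately have "5 * 5 ^ (m + 5) dvd 5 * (288 * (U ?n - (1 + 5 ^ (4 * B + b)) * U (4 * B + b) - int K * P))"
    by (simp only:)
  then have "5 ^ (m + 5) dvd 288 * (U ?n - (1 + 5 ^ (4 * B + b)) * U (4 * B + b) - int K * P)"
    by (rule dvd_mult_cancel_left[THEN iffD1, THEN disjE]) simp_all
  moreover have "coprime (5::int) 288" by (rule prime_imp_coprime) simp_all
  then have "coprime ((5::int) ^ (m + 5)) 288" by simp
  ultimately show ?thesis
    by (simp only: coprime_dvd_mult_right_iff cong_iff_dvd_diff)
qed

section \<open>Explicit values\<close>

text \<open>Lists and quotients of factorials let the simplifier evaluate the right-hand side.\<close>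

lemma U_even_rec:
  assumes "n > 0"
  shows "U (2 * n) = - 2 * (\<Sum>j\<leftarrow>[1..<Suc n]. int (fact (2 * n) div (fact (2 * j) * fact (2 * n - 2 * j))) * U (2 * (n - j)))"
proof -
  have "U (2 * n) = - 2 * (\<Sum>j = 1..n. int ((2 * n) choose (2 * j)) * U (2 * n - 2 * j))"
    using U_rec[of "2 * n"] assms by simp
  also have "(\<Sum>j = 1..n. int ((2 * n) choose (2 * j)) * U (2 * n - 2 * j)) =
     (\<Sum>j = 1..n. int (fact (2 * n) div (fact (2 * j) * fact (2 * n - 2 * j))) * U (2 * (n - j)))"
    by (rule sum.cong) (auto simp: binomial_fact' diff_mult_distrib2)
  finally show ?thesis
    by (simp only: sum_set_upt_conv_sum_list_nat[symmetric] set_upt atLeastLessThanSuc_atLeastAtMost)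
qed

lemma U2: "U 2 = -2" using U_even_rec[of 1] by (simp add: U_0)
lemma U4: "U 4 = 22"
  using U_even_rec[of 2]
  by (simp add: upt_rec[of "Suc 0"] numeral_2_eq_2[symmetric] fact_numeral U_0 U2)

lemma U6: "U 6 = -602"
  using U_even_rec[of 3]
  by (simp add: upt_rec[of "Suc 0"] numeral_2_eq_2[symmetric] fact_numeral U_0 U2 U4)

lemma U8: "U 8 = 30742"
  using U_even_rec[of 4]
  by (simp add: upt_rec[of "Suc 0"] numeral_2_eq_2[symmetric] fact_numeral U_0 U2 U4 U6)

lemma U10: "U 10 = -2523002"
  using U_even_rec[of 5]
  by (simp add: upt_rec[of "Suc 0"] numeral_2_eq_2[symmetric] fact_numeral U_0 U2 U4 U6 U8)

lemma U12: "U 12 = 303692662"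
  using U_even_rec[of 6]
  by (simp add: upt_rec[of "Suc 0"] numeral_2_eq_2[symmetric] fact_numeral U_0 U2 U4 U6 U8 U10)

lemma U14: "U 14 = -50402079002"
  using U_even_rec[of 7]
  by (simp add: upt_rec[of "Suc 0"] numeral_2_eq_2[symmetric] fact_numeral U_0 U2 U4 U6 U8 U10 U12)

lemma U16: "U 16 = 11030684333782"
  using U_even_rec[of 8]
  by (simp add: upt_rec[of "Suc 0"] numeral_2_eq_2[symmetric] fact_numeral
      U_0 U2 U4 U6 U8 U10 U12 U14)

lemma U18: "U 18 = -3077986048956602"
  using U_even_rec[of 9]
  by (simp add: upt_rec[of "Suc 0"] numeral_2_eq_2[symmetric] fact_numeral
      U_0 U2 U4 U6 U8 U10 U12 U14 U16)

lemma U20: "U 20 = 1066578948824962102"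
  using U_even_rec[of 10]
  by (simp add: upt_rec[of "Suc 0"] numeral_2_eq_2[symmetric] fact_numeral
      U_0 U2 U4 U6 U8 U10 U12 U14 U16 U18)

lemma U22: "U 22 = -449342758735568563802"
  using U_even_rec[of 11]
  by (simp add: upt_rec[of "Suc 0"] numeral_2_eq_2[symmetric] fact_numeral
      U_0 U2 U4 U6 U8 U10 U12 U14 U16 U18 U20)

lemma U24: "U 24 = 226182806795367665865622"
  using U_even_rec[of 12]
  by (simp add: upt_rec[of "Suc 0"] numeral_2_eq_2[symmetric] fact_numeral
      U_0 U2 U4 U6 U8 U10 U12 U14 U16 U18 U20 U22)

lemma U26: "U 26 = -134065091768709178087428602"
  using U_even_rec[of 13]
  by (simp add: upt_rec[of "Suc 0"] numeral_2_eq_2[symmetric] fact_numeral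
      U_0 U2 U4 U6 U8 U10 U12 U14 U16 U18 U20 U22 U24)

lemma sum_atMost_conv_sum_list_int: "(\<Sum>j\<le>n. f j) = (\<Sum>j\<leftarrow>[0..<Suc n]. f j)" for f :: "nat \<Rightarrow> int"
  by (simp only: sum_set_upt_conv_sum_list_nat[symmetric] set_upt lessThan_Suc_atMost[symmetric] lessThan_atLeast0)

lemma sum_1_6: "(\<Sum>r=1..6. f r) = f 1 + f 2 + f 3 + f 4 + f 5 + f (6::nat)" for f :: "nat \<Rightarrow> int"
  by (simp add: eval_nat_numeral)

text \<open>The qualified method name avoids the homonymous method of HOL-Algebra.\<close>

lemma ffact_eval:
  fixes y :: int
  shows "(\<Prod>i<2. y - int i) = y ^ 2 - y"
    and "(\<Prod>i<3. y - int i) = y ^ 3 - 3 * y ^ 2 + 2 * y"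
    and "(\<Prod>i<4. y - int i) = y ^ 4 - 6 * y ^ 3 + 11 * y ^ 2 - 6 * y"
    and "(\<Prod>i<5. y - int i) = y ^ 5 - 10 * y ^ 4 + 35 * y ^ 3 - 50 * y ^ 2 + 24 * y"
proof -
  have Suc: "(\<Prod>i<Suc r. y - int i) = (\<Prod>i<r. y - int i) * (y - int r)" for r
    by (rule prod.lessThan_Suc)
  have "(\<Prod>i<2. y - int i) = y * (y - 1)"
    by (simp add: numeral_2_eq_2)
  then show 2: "(\<Prod>i<2. y - int i) = y ^ 2 - y"
    by (simp add: power2_eq_square right_diff_distrib)
  have "(\<Prod>i<3. y - int i) = (\<Prod>i<2. y - int i) * (y - 2)"
    using Suc[of 2] by simp
  also have "\<dots> = y ^ 3 - 3 * y ^ 2 + 2 * y" unfolding 2 by Groebner_Basis.algebra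
  finally show 3: "(\<Prod>i<3. y - int i) = y ^ 3 - 3 * y ^ 2 + 2 * y" .
  have "(\<Prod>i<4. y - int i) = (\<Prod>i<3. y - int i) * (y - 3)"
    using Suc[of 3] by simp
  also have "\<dots> = y ^ 4 - 6 * y ^ 3 + 11 * y ^ 2 - 6 * y" unfolding 3 by Groebner_Basis.algebra
  finally show 4: "(\<Prod>i<4. y - int i) = y ^ 4 - 6 * y ^ 3 + 11 * y ^ 2 - 6 * y" .
  have "(\<Prod>i<5. y - int i) = (\<Prod>i<4. y - int i) * (y - 4)"
    using Suc[of 4] by simp
  also have "\<dots> = y ^ 5 - 10 * y ^ 4 + 35 * y ^ 3 - 50 * y ^ 2 + 24 * y"
    unfolding 4 by Groebner_Basis.algebra
  finally show "(\<Prod>i<5. y - int i) = y ^ 5 - 10 * y ^ 4 + 35 * y ^ 3 - 50 * y ^ 2 + 24 * y" .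
qed

lemma ffact_deriv_eval:
  "ffact_deriv 1 y = 1"
  "ffact_deriv 2 y = 2 * y - 1"
  "ffact_deriv 3 y = 3 * y ^ 2 - 6 * y + 2"
  "ffact_deriv 4 y = 4 * y ^ 3 - 18 * y ^ 2 + 22 * y - 6"
  "ffact_deriv 5 y = 5 * y ^ 4 - 40 * y ^ 3 + 105 * y ^ 2 - 100 * y + 24"
  "ffact_deriv 6 y = 6 * y ^ 5 - 75 * y ^ 4 + 340 * y ^ 3 - 675 * y ^ 2 + 548 * y - 120"
proof -
  note Suc = ffact_deriv.simps(2)[of _ y]
  show "ffact_deriv 1 y = 1" by simp
  show 2: "ffact_deriv 2 y = 2 * y - 1"
    by (simp add: numeral_2_eq_2)
  have "ffact_deriv 3 y = ffact_deriv 2 y * (y - 2) + (\<Prod>i<2. y - int i)"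
    using Suc[of 2] by simp
  also have "\<dots> = 3 * y ^ 2 - 6 * y + 2" unfolding 2 ffact_eval by Groebner_Basis.algebra
  finally show 3: "ffact_deriv 3 y = 3 * y ^ 2 - 6 * y + 2" .
  have "ffact_deriv 4 y = ffact_deriv 3 y * (y - 3) + (\<Prod>i<3. y - int i)"
    using Suc[of 3] by simp
  also have "\<dots> = 4 * y ^ 3 - 18 * y ^ 2 + 22 * y - 6"
    unfolding 3 ffact_eval by Groebner_Basis.algebra
  finally show 4: "ffact_deriv 4 y = 4 * y ^ 3 - 18 * y ^ 2 + 22 * y - 6" .
  have "ffact_deriv 5 y = ffact_deriv 4 y * (y - 4) + (\<Prod>i<4. y - int i)"
    using Suc[of 4] by simp
  also have "\<dots> = 5 * y ^ 4 - 40 * y ^ 3 + 105 * y ^ 2 - 100 * y + 24"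
    unfolding 4 ffact_eval by Groebner_Basis.algebra
  finally show 5: "ffact_deriv 5 y = 5 * y ^ 4 - 40 * y ^ 3 + 105 * y ^ 2 - 100 * y + 24" .
  have "ffact_deriv 6 y = ffact_deriv 5 y * (y - 5) + (\<Prod>i<5. y - int i)"
    using Suc[of 5] by simp
  also have "\<dots> = 6 * y ^ 5 - 75 * y ^ 4 + 340 * y ^ 3 - 675 * y ^ 2 + 548 * y - 120"
    unfolding 5 ffact_eval by Groebner_Basis.algebra
  finally show "ffact_deriv 6 y = 6 * y ^ 5 - 75 * y ^ 4 + 340 * y ^ 3 - 675 * y ^ 2 + 548 * y - 120" .
qed

lemma kummer_0_values:
  "kummer 0 0 = 4"
  "kummer 0 (Suc 0) = 27544"
  "kummer 0 2 = 24017248984"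
  "kummer 0 3 = 148287433224572824"
  "kummer 0 4 = 3366297709306118985855064"
  "kummer 0 5 = 203433789982790620020080267111704"
  "kummer 0 6 = 26963091706677397449057078968542948918744"
  by (simp_all add: kummer_def U_0 U4 U8 U12 U16 U20 U24)

text \<open>Entry 0 of the list is a dummy.\<close>

lemma kummer_0_differences:
  assumes "0 < r" "r \<le> 6"
  shows "[(\<Sum>j\<le>r. (-1) ^ (r - j) * int (r choose j) * kummer 0 j) =
    [0, 27540, 6400, 17875, 10000, 40625, 15625] ! r] (mod 5 ^ 7)"
proof -
  have "r \<in> {1, 2, 3, 4, 5, 6}" using assms by auto
  then show ?thesis
    by (elim insertE emptyE)
       (simp_all add: sum_atMost_conv_sum_list_int upt_rec[of 0] upt_rec[of "Suc 0"] numeral_2_eq_2[symmetric]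
          binomial_fact' fact_numeral kummer_0_values cong_def)
qed

lemma kummer_2_values:
  "kummer 2 0 = -104"
  "kummer 2 (Suc 0) = -18813704"
  "kummer 2 2 = -49277387858504"
  "kummer 2 3 = -615259753543186970504"
  "kummer 2 4 = -23483169929179450039480725704"
  "kummer 2 5 = -2142633241346210252142014663519940104"
  "kummer 2 6 = -399545108582702810100907570441181173557669704"
  by (simp_all add: kummer_def U_0 U2 U2[unfolded numeral_2_eq_2] U6 U10 U14 U18 U22 U26)

text \<open>As the Newton expansion predicts, entry r is a multiple of 5^r. The leading 0 only
  aligns the list positions with r.\<close>

lemma kummer_2_differences:
  assumes "0 < r" "r \<le> 6"
  shows "[(\<Sum>j\<le>r. (-1) ^ (r - j) * int (r choose j) * kummer 2 j) =
    [0, 14525, 3175, 7750, 25625, 62500, 31250] ! r] (mod 5 ^ 7)"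
proof -
  have "r \<in> {1, 2, 3, 4, 5, 6}" using assms by auto
  then show ?thesis
    by (elim insertE emptyE)
       (simp_all add: sum_atMost_conv_sum_list_int upt_rec[of 0] upt_rec[of "Suc 0"] numeral_2_eq_2[symmetric]
          binomial_fact' fact_numeral kummer_2_values cong_def)
qed

section \<open>The two residue classes modulo 4\<close>

lemma U_cong_b_0_mod_4:
  assumes "5 ^ (m - 1) dvd K" "K > 0" "m \<ge> 5" and b: "b = 4 * B"
  shows "[U (4 * K + b) - (1 + 5 ^ b) * U b = int K *
          (7545 + 5050 * int b - 5375 * int b ^ 2 + 1250 * int b ^ 3
            + 3125 * int b ^ 4 + 9375 * int b ^ 5)] (mod 5 ^ (m + 5))"
proof -
  let ?P = "7545 + 5050 * int b - 5375 * int b ^ 2 + 1250 * int b ^ 3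
            + 3125 * int b ^ 4 + 9375 * int b ^ 5"
  \<comment> \<open>Quotient by 5^7 of the derivative sum minus 1440 \<open>?P\<close>, as a
    polynomial in B. Its integrality is what confirms the coefficients of \<open>?P\<close>.\<close>
  let ?q = "168 + (- 596) * int B + 1791 * int B ^ 2 + (- 1516) * int B ^ 3 + (- 14745) * int B ^ 4
    + (- 176946) * int B ^ 5"
  have "(\<Sum>r=1..6. 720 div fact r * ffact_deriv r (int B) *
      [0, 27540, 6400, 17875, 10000, 40625, 15625] ! r) = 1440 * ?P + 5 ^ 7 * ?q"
    unfolding sum_1_6 ffact_deriv_eval b by (simp add: fact_numeral power_mult_distrib algebra_simps)
  from U_cong_from_ffact_deriv[OF assms(1-3) kummer_0_differences this]
  show ?thesis by (simp add: b distrib_left)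
qed

lemma U_cong_b_2_mod_4:
  assumes "5 ^ (m - 1) dvd K" "K > 0" "m \<ge> 5" and b: "b = 4 * B + 2"
  shows "[U (4 * K + b) - (1 + 5 ^ b) * U b = int K *
          (- 1575 + 5350 * int b + 2250 * int b ^ 2 + 7500 * int b ^ 3
            + 3125 * int b ^ 5)] (mod 5 ^ (m + 5))"
proof -
  let ?P = "- 1575 + 5350 * int b + 2250 * int b ^ 2 + 7500 * int b ^ 3 + 3125 * int b ^ 5"
  let ?q = "(- 3132) + (- 26212) * int B + (- 87570) * int B ^ 2 + (- 156320) * int B ^ 3
    + (- 147462) * int B ^ 4 + (- 58980) * int B ^ 5"
  have int_b: "int b = 4 * int B + 2" using b by simp
  \<comment> \<open>Exactly the powers of b above the first that occur in \<open>?P\<close>; there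
    is no b^4.\<close>
  have pow: "(4 * x + 2) ^ 2 = 16 * x ^ 2 + 16 * x + 4"
    "(4 * x + 2) ^ 3 = 64 * x ^ 3 + 96 * x ^ 2 + 48 * x + 8"
    "(4 * x + 2) ^ 5 = 1024 * x ^ 5 + 2560 * x ^ 4 + 2560 * x ^ 3 + 1280 * x ^ 2 + 320 * x + 32"
    for x :: int
    by (simp_all add: eval_nat_numeral algebra_simps)
  have "(\<Sum>r=1..6. 720 div fact r * ffact_deriv r (int B) *
      [0, 14525, 3175, 7750, 25625, 62500, 31250] ! r) = 1440 * ?P + 5 ^ 7 * ?q"
    unfolding sum_1_6 ffact_deriv_eval int_b pow by (simp add: fact_numeral)
  from U_cong_from_ffact_deriv[OF assms(1-3) kummer_2_differences this]
  show ?thesis by (simp add: b distrib_left add.assoc)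
qed

theorem theorem3p1:
  fixes k m b :: nat
  assumes "k > 0" and "m \<ge> 5" and "even b"
  shows "([b = 0] (mod 4) \<longrightarrow>
      [U (k * totient (5 ^ m) + b) - (1 + 5 ^ b) * U b =
        5 ^ (m - 1) * int k *
          (7545 + 5050 * int b - 5375 * int b ^ 2 + 1250 * int b ^ 3
            + 3125 * int b ^ 4 + 9375 * int b ^ 5)] (mod 5 ^ (m + 5))) \<and>
    ([b = 2] (mod 4) \<longrightarrow>
      [U (k * totient (5 ^ m) + b) - (1 + 5 ^ b) * U b =
        5 ^ (m - 1) * int k *
          (- 1575 + 5350 * int b + 2250 * int b ^ 2 + 7500 * int b ^ 3
            + 3125 * int b ^ 5)] (mod 5 ^ (m + 5)))"
proof -
  \<comment> \<open>As the totient is 4 * 5^(m-1), the index shift is 4 K, that is K steps of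
    \<open>kummer\<close>.\<close>
  define K where "K = 5 ^ (m - 1) * k"
  have K: "5 ^ (m - 1) dvd K" "K > 0" using assms(1) by (simp_all add: K_def)
  have int_K: "int K = 5 ^ (m - 1) * int k" by (simp add: K_def)
  have "totient (5 ^ m) = 5 ^ (m - 1) * 4"
    using assms(2) totient_prime_power[of 5 m] by simp
  then have tot: "k * totient (5 ^ m) = 4 * K" by (simp add: K_def)
  show ?thesis
    unfolding tot int_K[symmetric]
  proof (intro conjI impI)
    assume "[b = 0] (mod 4)"
    then have "b = 4 * (b div 4)" using div_mult_mod_eq[of b 4] by (simp add: cong_def)
    then show "[U (4 * K + b) - (1 + 5 ^ b) * U b = int K *
          (7545 + 5050 * int b - 5375 * int b ^ 2 + 1250 * int b ^ 3
            + 3125 * int b ^ 4 + 9375 * int b ^ 5)] (mod 5 ^ (m + 5))"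
      by (rule U_cong_b_0_mod_4[OF K assms(2)])
  next
    assume "[b = 2] (mod 4)"
    then have "b = 4 * (b div 4) + 2" using div_mult_mod_eq[of b 4] by (simp add: cong_def)
    then show "[U (4 * K + b) - (1 + 5 ^ b) * U b = int K *
          (- 1575 + 5350 * int b + 2250 * int b ^ 2 + 7500 * int b ^ 3
            + 3125 * int b ^ 5)] (mod 5 ^ (m + 5))"
      by (rule U_cong_b_2_mod_4[OF K assms(2)])
  qed
qed

end
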